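(* Let $s\in\{1,\dots,p\}$, $\gamma\in(0,1)$, $\tau\in[0,1-\gamma)$, and set $c_0=c_0(\gamma,\tau)=\frac{1+\gamma+\tau}{1-\gamma-\tau}$. Assume that the condition $SRE(s,c_0)$ holds for $\mathbb X$. Let $\lambda$ satisfy $$\lambda\ge\frac{(4+\sqrt2)\sigma}{\gamma}\sqrt{\frac{\log(2ep/s)}{n}},\qquad\text{and set}\qquad \delta(\lambda)=\exp\Big(-\Big(\frac{\gamma\lambda\sqrt n}{(4+\sqrt2)\sigma}\Big)^2\Big).$$ Let $\delta_0\in(0,1)$, and consider the event $$\Omega=\Big\{\tfrac1n\boldsymbol\xi^T\mathbb X\boldsymbol u\le\max\big(H(\boldsymbol u),G(\boldsymbol u)\big)\ \ \forall\boldsymbol u\in\mathbb R^p\Big\}.$$ Then, on the event $\Omega$, the Lasso estimator $\hat{\boldsymbol\beta}$ with tuning parameter $\lambda$ satisfies $$2\tau\lambda|\hat{\boldsymbol\beta}-\boldsymbol\beta|_1+\|\mathbb X\hat{\boldsymbol\beta}-\mathbf f\|_n^2\le\|\mathbb X\boldsymbol\beta-\mathbf f\|_n^2+C_{\gamma,\tau}(s,\lambda,\delta_0)\,\lambda^2 s$$ for all $\boldsymbol\beta\in\mathbb R^p$ with $|\boldsymbol\beta|_0\le s$ and all $\mathbf f\in\mathbb R^n$, where $$C_{\gamma,\tau}(s,\lambda,\delta_0)=(1+\gamma+\tau)^2\left(\frac{\log(1/\delta_0)}{s\log(1/\delta(\lambda))}\vee\frac1{\theta^2(s,c_0(\gamma,\tau))}\right).$$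 Furthermore, if $\mathbf f=\mathbb X\boldsymbol\beta^*$ for some $\boldsymbol\beta^*\in\mathbb R^p$ with $|\boldsymbol\beta^*|_0\le s$, then on the event $\Omega$, for every $1\le q\le2$, $$|\hat{\boldsymbol\beta}-\boldsymbol\beta^*|_q\le\Big(\frac{C_{\gamma,\tau}(s,\lambda,\delta_0)}{2\tau}\Big)^{2/q-1}\Big(\frac{C_{\gamma,0}(s,\lambda,\delta_0)}{1+\gamma}\Big)^{2-2/q}\lambda s^{1/q}$$ (where, if $\tau=0$, the first factor is read as $+\infty$ for $q<2$ and as $1$ for $q=2$).
   Context: Let $n,p\ge1$ be integers, $\sigma>0$, $\mathbb X\in\mathbb R^{n\times p}$ a deterministic matrix, $\mathbf f\in\mathbb R^n$ deterministic, $\boldsymbol\xi\sim\mathcal N(\mathbf 0,\sigma^2I_{n\times n})$, and $\mathbf y=\mathbf f+\boldsymbol\xi$. For $\boldsymbol u\in\mathbb R^n$, $\|\boldsymbol u\|_n^2=\frac1n\sum_{i=1}^nu_i^2$. $|\cdot|_q$ is the $\ell_q$ norm on $\mathbb R^p$, $|\boldsymbol\beta|_0$ is the number of nonzero components of $\boldsymbol\beta$, $a\vee b=\max(a,b)$, and $\boldsymbol e_1,\dots,\boldsymbol e_p$ is the canonical basis of $\mathbb R^p$. Lasso estimator with tuning parameter $\lambda>0$: any $\hat{\boldsymbol\beta}\in\arg\min_{\boldsymbol\beta\in\mathbb R^p}\big(\|\mathbb X\boldsymbol\beta-\mathbf y\|_n^2+2\lambda|\boldsymbol\beta|_1\big)$.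 Condition $SRE(s,c_0)$ ($c_0>0$): $\|\mathbb X\boldsymbol e_j\|_n\le1$ for all $j=1,\dots,p$, and $$\theta(s,c_0)=\min_{\boldsymbol\delta\in\mathcal C_{SRE}(s,c_0),\,\boldsymbol\delta\ne\mathbf 0}\frac{\|\mathbb X\boldsymbol\delta\|_n}{|\boldsymbol\delta|_2}>0,\qquad\mathcal C_{SRE}(s,c_0)=\{\boldsymbol\delta\in\mathbb R^p:|\boldsymbol\delta|_1\le(1+c_0)\sqrt s\,|\boldsymbol\delta|_2\}.$$ For $\delta_0\in(0,1)$ and $\boldsymbol u\in\mathbb R^p$, with $u_1^\sharp\ge\dots\ge u_p^\sharp$ a non-increasing rearrangement of $|u_1|,\dots,|u_p|$, $$H(\boldsymbol u)=(4+\sqrt2)\sum_{j=1}^pu_j^\sharp\,\sigma\sqrt{\frac{\log(2p/j)}n},\qquad G(\boldsymbol u)=(4+\sqrt2)\,\sigma\sqrt{\frac{\log(1/\delta_0)}n}\,\|\mathbb X\boldsymbol u\|_n.$$ *)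

theory Defs
  imports "HOL-Probability.Probability"
begin

text \<open>
  The sample size is \<^term>\<open>CARD('n)\<close> and the number of predictors is \<^term>\<open>CARD('p)\<close>, so the design
  matrix has type \<^typ>\<open>real ^ 'p ^ 'n\<close>. The \<open>\<ell>\<^sub>2\<close> norm is the library's \<^const>\<open>norm\<close>.
\<close>

definition lq_norm :: "real \<Rightarrow> real ^ 'p \<Rightarrow> real" where
  "lq_norm q v = (\<Sum>j\<in>UNIV. \<bar>v $ j\<bar> powr q) powr (1 / q)"

lemma lq_norm_1: "lq_norm 1 v = (\<Sum>j\<in>UNIV. \<bar>v $ j\<bar>)"
  by (simp add: lq_norm_def sum_nonneg)

lemma lq_norm_2: "lq_norm 2 v = norm v"
  by (simp add: lq_norm_def norm_vec_def L2_set_def powr_half_sqrt sum_nonneg)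

definition l0_norm :: "real ^ 'p \<Rightarrow> nat" where
  "l0_norm v = card {j. v $ j \<noteq> 0}"

definition emp_norm :: "real ^ 'n \<Rightarrow> real" where
  "emp_norm u = sqrt ((\<Sum>i\<in>UNIV. (u $ i)\<^sup>2) / real CARD('n))"

definition is_lasso :: "real ^ 'p ^ 'n \<Rightarrow> real \<Rightarrow> real ^ 'n \<Rightarrow> real ^ 'p \<Rightarrow> bool" where
  "is_lasso X lam y b \<longleftrightarrow>
     is_arg_min (\<lambda>\<beta>. (emp_norm (X *v \<beta> - y))\<^sup>2 + 2 * lam * lq_norm 1 \<beta>) (\<lambda>_. True) b"

definition SRE_cone :: "nat \<Rightarrow> real \<Rightarrow> (real ^ 'p) set" where
  "SRE_cone s c0 = {\<delta>. lq_norm 1 \<delta> \<le> (1 + c0) * sqrt (real s) * norm \<delta>}"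

text \<open>The infimum below is attained whenever the cone is nontrivial; see \<open>theta_attained\<close>.\<close>

definition theta :: "real ^ 'p ^ 'n \<Rightarrow> nat \<Rightarrow> real \<Rightarrow> real" where
  "theta X s c0 = (INF \<delta>\<in>SRE_cone s c0 - {0}. emp_norm (X *v \<delta>) / norm \<delta>)"

definition SRE :: "real ^ 'p ^ 'n \<Rightarrow> nat \<Rightarrow> real \<Rightarrow> bool" where
  "SRE X s c0 \<longleftrightarrow> (\<forall>j. emp_norm (X *v axis j 1) \<le> 1) \<and> theta X s c0 > 0"

lemma emp_norm_scaleR: "emp_norm (c *\<^sub>R u) = \<bar>c\<bar> * emp_norm u"
  by (simp add: emp_norm_def power_mult_distrib real_sqrt_mult flip: sum_distrib_left times_divide_eq_right)

lemma theta_attained: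
  fixes X :: "real ^ 'p ^ 'n"
  assumes "1 \<le> s" "0 < c0"
  shows "\<exists>\<delta>\<in>SRE_cone s c0 - {0}. theta X s c0 = emp_norm (X *v \<delta>) / norm \<delta> \<and>
           (\<forall>\<delta>'\<in>SRE_cone s c0 - {0}. emp_norm (X *v \<delta>) / norm \<delta> \<le> emp_norm (X *v \<delta>') / norm \<delta>')"
proof -
  define g :: "real ^ 'p \<Rightarrow> real" where "g \<delta> = emp_norm (X *v \<delta>)" for \<delta>
  define K :: "(real ^ 'p) set" where "K = sphere 0 1 \<inter> SRE_cone s c0"
  have g_cont: "continuous_on UNIV g"
    unfolding g_def emp_norm_def matrix_vector_mult_def
    by (intro continuous_intros) auto
  have "closed (SRE_cone s c0 :: (real ^ 'p) set)"
    unfolding SRE_cone_def lq_norm_1 by (intro closed_Collect_le continuous_intros)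
  hence "compact K"
    unfolding K_def by (intro compact_Int_closed compact_sphere)
  moreover have "axis undefined 1 \<in> K"
  proof -
    have l1: "lq_norm 1 (axis undefined 1 :: real ^ 'p) = 1"
      by (simp add: lq_norm_1 axis_def if_distrib cong: if_cong)
    have "1 * 1 \<le> (1 + c0) * sqrt (real s)"
      using assms by (intro mult_mono) auto
    with l1 show ?thesis by (simp add: K_def SRE_cone_def norm_axis_1)
  qed
  ultimately obtain d where d: "d \<in> K" "\<And>d'. d' \<in> K \<Longrightarrow> g d \<le> g d'"
    using continuous_attains_inf[of K g] continuous_on_subset[OF g_cont] by blast
  have dn: "norm d = 1" and dC: "d \<in> SRE_cone s c0 - {0}"
    using d(1) by (auto simp: K_def)
  have min: "g d / norm d \<le> g d' / norm d'" if "d' \<in> SRE_cone s c0 - {0}" for d'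
  proof -
    let ?e = "(1 / norm d') *\<^sub>R d'"
    have "norm d' > 0" using that by auto
    have "lq_norm 1 ?e = lq_norm 1 d' / norm d'"
      by (simp add: lq_norm_1 abs_mult sum_divide_distrib)
    moreover have "lq_norm 1 d' / norm d' \<le> (1 + c0) * sqrt (real s)"
      using that \<open>norm d' > 0\<close> by (simp add: SRE_cone_def pos_divide_le_eq)
    moreover have "norm ?e = 1"
      using \<open>norm d' > 0\<close> by simp
    ultimately have "?e \<in> K"
      by (simp add: K_def SRE_cone_def)
    moreover have "g ?e = g d' / norm d'"
      by (simp only: g_def matrix_vector_mult_scaleR emp_norm_scaleR) simp
    ultimately show ?thesis using d(2)[of ?e] dn by simp
  qed
  have "theta X s c0 = g d / norm d"
    unfolding theta_def g_def[symmetric]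
    by (rule cInf_eq_minimum) (use dC min in auto)
  with dC min show ?thesis unfolding g_def by blast
qed

text \<open>\<open>decr_rearr u j\<close> is the \<open>j\<close>-th largest absolute value of the entries of \<open>u\<close>, for \<open>1 \<le> j \<le> CARD('p)\<close>.\<close>

definition decr_rearr :: "real ^ 'p \<Rightarrow> nat \<Rightarrow> real" where
  "decr_rearr u j =
     rev (sorted_list_of_multiset (image_mset (\<lambda>i. \<bar>u $ i\<bar>) (mset_set UNIV))) ! (j - 1)"

definition H_fun :: "'n itself \<Rightarrow> real \<Rightarrow> real ^ 'p \<Rightarrow> real" where
  "H_fun TYPE('n) \<sigma> u =
     (4 + sqrt 2) * (\<Sum>j = 1..CARD('p). decr_rearr u j * \<sigma> *
        sqrt (ln (2 * real CARD('p) / real j) / real CARD('n)))"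

definition G_fun :: "real ^ 'p ^ 'n \<Rightarrow> real \<Rightarrow> real \<Rightarrow> real ^ 'p \<Rightarrow> real" where
  "G_fun X \<sigma> \<delta>0 u =
     (4 + sqrt 2) * \<sigma> * sqrt (ln (1 / \<delta>0) / real CARD('n)) * emp_norm (X *v u)"

definition isotropic_gaussian :: "'w measure \<Rightarrow> real \<Rightarrow> ('w \<Rightarrow> real ^ 'n) \<Rightarrow> bool" where
  "isotropic_gaussian M \<sigma> \<xi> \<longleftrightarrow>
     prob_space.indep_vars M (\<lambda>_. borel) (\<lambda>i \<omega>. \<xi> \<omega> $ i) UNIV \<and>
     (\<forall>i. distributed M lborel (\<lambda>\<omega>. \<xi> \<omega> $ i) (normal_density 0 \<sigma>))"

definition Omega_event ::
  "'w measure \<Rightarrow> ('w \<Rightarrow> real ^ 'n) \<Rightarrow> real ^ 'p ^ 'n \<Rightarrow> real \<Rightarrow> real \<Rightarrow> 'w set" where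
  "Omega_event M \<xi> X \<sigma> \<delta>0 =
     {\<omega> \<in> space M. \<forall>u. (\<xi> \<omega> \<bullet> (X *v u)) / real CARD('n) \<le> max (H_fun TYPE('n) \<sigma> u) (G_fun X \<sigma> \<delta>0 u)}"

definition c0_const :: "real \<Rightarrow> real \<Rightarrow> real" where
  "c0_const \<gamma> \<tau> = (1 + \<gamma> + \<tau>) / (1 - \<gamma> - \<tau>)"

definition delta_lam :: "'n itself \<Rightarrow> real \<Rightarrow> real \<Rightarrow> real \<Rightarrow> real" where
  "delta_lam TYPE('n) \<sigma> \<gamma> lam = exp (- (\<gamma> * lam * sqrt (real CARD('n)) / ((4 + sqrt 2) * \<sigma>))\<^sup>2)"

definition C_const ::
  "real ^ 'p ^ 'n \<Rightarrow> real \<Rightarrow> real \<Rightarrow> real \<Rightarrow> nat \<Rightarrow> real \<Rightarrow> real \<Rightarrow> real" where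
  "C_const X \<sigma> \<gamma> \<tau> s lam \<delta>0 =
     (1 + \<gamma> + \<tau>)\<^sup>2 *
       max (ln (1 / \<delta>0) / (real s * ln (1 / delta_lam TYPE('n) \<sigma> \<gamma> lam)))
           (1 / (theta X s (c0_const \<gamma> \<tau>))\<^sup>2)"

text \<open>
  \<open>(C / (2\<tau>))\<close> to the power \<open>2/q - 1\<close>, extended-real valued because for \<open>\<tau> = 0\<close> it is read as
  \<open>\<infinity>\<close> when \<open>q < 2\<close> and as \<open>1\<close> when \<open>q = 2\<close>.
\<close>

definition tau_factor :: "real \<Rightarrow> real \<Rightarrow> real \<Rightarrow> ereal" where
  "tau_factor C \<tau> q =
     (if \<tau> = 0 then (if q < 2 then \<infinity> else 1) else ereal ((C / (2 * \<tau>)) powr (2 / q - 1)))"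

end

theory Submission
  imports Defs
begin

text \<open>
  The argument is pathwise: fix an outcome in the event and let \<open>\<xi>\<close> be its noise vector. Write \<open>u\<close> for the difference between the Lasso and
  a competitor \<open>\<beta>\<close> with at most \<open>s\<close> nonzero entries, and \<open>R\<close> for the empirical norm of \<open>X u\<close>.

  Optimality of the Lasso, improved by convexity (\<open>lasso_optimality\<close>), leaves an extra \<open>R\<^sup>2\<close> on the
  left-hand side; the right-hand side consists of the error of \<open>\<beta>\<close> and twice the sum of the noise term
  and \<open>lam\<close> times the difference of the two penalties. Add \<open>2 \<tau> lam |u|\<^sub>1\<close> to both sides and let \<open>2 D\<close>
  be what then exceeds the error of \<open>\<beta>\<close>. It has to be played against \<open>R\<^sup>2\<close>. Let \<open>B\<close> be the \<open>\<ell>\<^sub>1\<close> mass of \<open>u\<close> outside its \<open>s\<close>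
  largest entries. Cauchy--Schwarz and Stirling's bound turn the weights of \<open>H\<close> into
  \<open>H \<le> \<gamma> lam (\<surd>s |u|\<^sub>2 + B)\<close> (\<open>H_fun_le_largest_entries\<close>), while sparsity of \<open>\<beta>\<close> bounds the penalty
  difference by the mass of the \<open>s\<close> largest entries minus \<open>B\<close>
  (\<open>l1_difference_le_largest_entries\<close>).

  Two cases remain. If \<open>\<gamma> lam (\<surd>s |u|\<^sub>2 + B)\<close> dominates \<open>G\<close>, then either \<open>D < 0\<close> or the coefficients
  of \<open>\<surd>s |u|\<^sub>2\<close> and \<open>B\<close> force \<open>u\<close> into the cone on which the restricted eigenvalue \<open>\<theta>\<close> gives
  \<open>|u|\<^sub>2 \<le> R / \<theta>\<close>. Otherwise \<open>\<surd>s |u|\<^sub>2 + B\<close> is itself at most a multiple of \<open>R\<close>, because \<open>G\<close> is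
  one. Either way \<open>|u|\<^sub>2\<close> and \<open>D\<close> are bounded by multiples of \<open>R\<close> (\<open>noise_penalty_dichotomy\<close>), and
  the maximum in the constant \<open>C\<close> is the maximum over the two cases.

  Completing the square gives the prediction bound, which for \<open>f = X \<beta>\<close> and \<open>\<tau> > 0\<close> contains the
  \<open>\<ell>\<^sub>1\<close> bound. For \<open>f = X \<beta>\<close> optimality also yields \<open>R\<^sup>2 \<le> D\<close> at \<open>\<tau> = 0\<close>, which bounds \<open>R\<close> and then
  \<open>|u|\<^sub>2\<close>. The intermediate norms follow by interpolation (\<open>lq_norm_interpolation\<close>).
\<close>

section \<open>The optimality inequality of the Lasso\<close>

lemma emp_norm_sq: "(emp_norm (v :: real ^ 'n))\<^sup>2 = (v \<bullet> v) / real CARD('n)"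
  by (simp add: emp_norm_def sum_nonneg inner_vec_def power2_eq_square)

lemma emp_norm_nonneg: "0 \<le> emp_norm v"
  by (simp add: emp_norm_def sum_nonneg)

text \<open>
  Minimality alone would give the inequality without the term \<open>(emp_norm (X *v (b - \<beta>)))\<^sup>2\<close>. That term
  is gained by comparing \<open>b\<close> not with \<open>\<beta>\<close> but with a point \<open>b + t (\<beta> - b)\<close>: the penalty
  changes at most linearly in \<open>t\<close> by convexity, so letting \<open>t\<close> tend to \<open>0\<close> yields the first-order
  condition for the quadratic part, and expanding the squares recovers the missing term.
\<close>

lemma lasso_optimality:
  fixes X :: "real ^ 'p ^ 'n"
  assumes lasso: "is_lasso X lam (f + \<xi>) b" and lam: "0 \<le> lam"
  shows "(emp_norm (X *v b - f))\<^sup>2 + (emp_norm (X *v (b - \<beta>)))\<^sup>2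
    \<le> (emp_norm (X *v \<beta> - f))\<^sup>2
      + 2 * ((\<xi> \<bullet> (X *v (b - \<beta>))) / real CARD('n) + lam * (lq_norm 1 \<beta> - lq_norm 1 b))"
proof -
  define N where "N = real CARD('n)"
  have N: "N > 0" by (simp add: N_def)
  define v where "v = X *v (b - \<beta>)"
  define r where "r = X *v b - (f + \<xi>)"
  define A where "A = (r \<bullet> v) / N"
  define R where "R = (v \<bullet> v) / N"
  have R: "R \<ge> 0" using N by (simp add: R_def)
  have step: "2 * A \<le> t * R + 2 * lam * (lq_norm 1 \<beta> - lq_norm 1 b)" if t: "0 < t" "t \<le> 1" for t
  proof -
    define c where "c = b + t *\<^sub>R (\<beta> - b)"
    have "X *v c - (f + \<xi>) = r - t *\<^sub>R v"
      by (simp add: c_def r_def v_def matrix_vector_right_distrib matrix_vector_mult_diff_distrib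
          matrix_vector_mult_scaleR algebra_simps)
    hence "(emp_norm (X *v c - (f + \<xi>)))\<^sup>2 = ((r - t *\<^sub>R v) \<bullet> (r - t *\<^sub>R v)) / N"
      by (simp only: emp_norm_sq N_def)
    also have "\<dots> = (r \<bullet> r) / N - 2 * t * A + t\<^sup>2 * R"
      using N by (simp add: A_def R_def inner_diff_left inner_diff_right
          inner_commute field_simps power2_eq_square)
    finally have "(emp_norm (X *v c - (f + \<xi>)))\<^sup>2 = (r \<bullet> r) / N - 2 * t * A + t\<^sup>2 * R" .
    moreover have "lq_norm 1 c \<le> (1 - t) * lq_norm 1 b + t * lq_norm 1 \<beta>"
    proof -
      have "\<bar>c $ j\<bar> \<le> (1 - t) * \<bar>b $ j\<bar> + t * \<bar>\<beta> $ j\<bar>" for j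
      proof -
        have "c $ j = (1 - t) * b $ j + t * \<beta> $ j" by (simp add: c_def algebra_simps)
        thus ?thesis using abs_triangle_ineq[of "(1 - t) * b $ j" "t * \<beta> $ j"] t
          by (simp add: abs_mult)
      qed
      thus ?thesis
        by (simp add: lq_norm_1 sum_distrib_left flip: sum.distrib) (intro sum_mono, simp)
    qed
    hence "2 * lam * lq_norm 1 c \<le> 2 * lam * ((1 - t) * lq_norm 1 b + t * lq_norm 1 \<beta>)"
      using lam by (intro mult_left_mono) auto
    moreover have "(r \<bullet> r) / N + 2 * lam * lq_norm 1 b
        \<le> (emp_norm (X *v c - (f + \<xi>)))\<^sup>2 + 2 * lam * lq_norm 1 c"
      using lasso unfolding is_lasso_def is_arg_min_linorder
      by (auto simp: emp_norm_sq N_def r_def)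
    ultimately have "t * (2 * A) \<le> t * (t * R + 2 * lam * (lq_norm 1 \<beta> - lq_norm 1 b))"
      by (simp add: algebra_simps power2_eq_square)
    thus ?thesis using t by simp
  qed
  have A: "2 * A \<le> 2 * lam * (lq_norm 1 \<beta> - lq_norm 1 b)"
  proof (rule field_le_epsilon)
    fix e :: real assume e: "e > 0"
    define t where "t = min 1 (e / (R + 1))"
    have t: "0 < t" "t \<le> 1" using e R by (auto simp: t_def)
    have "t * R \<le> e / (R + 1) * (R + 1)" using e R t by (intro mult_mono) (auto simp: t_def)
    thus "2 * A \<le> 2 * lam * (lq_norm 1 \<beta> - lq_norm 1 b) + e"
      using step[OF t] R by simp
  qed
  have "X *v \<beta> - f = (X *v b - f) - v"
    by (simp add: v_def matrix_vector_mult_diff_distrib)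
  moreover have "X *v b - f = r + \<xi>" by (simp add: r_def)
  ultimately have "(emp_norm (X *v b - f))\<^sup>2 + (emp_norm v)\<^sup>2 - (emp_norm (X *v \<beta> - f))\<^sup>2
      = 2 * A + 2 * ((\<xi> \<bullet> v) / N)"
    by (simp add: emp_norm_sq N_def[symmetric] A_def inner_diff_left inner_diff_right inner_add_left
        inner_add_right inner_commute add_divide_distrib diff_divide_distrib)
  thus ?thesis using A by (simp add: v_def N_def algebra_simps)
qed

section \<open>Bounding the sorted penalty by the largest entries\<close>

text \<open>The logarithmic form of \<open>s! \<ge> (s / e) ^ s\<close>.\<close>

lemma sum_ln_ge: "real s * ln (real s) - real s \<le> (\<Sum>j=1..s. ln (real j))"
proof (induction s)
  case (Suc s)
  show ?case
  proof (cases "s = 0")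
    case False
    have "ln (real (Suc s)) - ln (real s) = ln (1 + 1 / real s)"
      using ln_div[of "real (Suc s)" "real s"] False by (simp add: add_divide_distrib add.commute)
    also have "\<dots> \<le> 1 / real s" by (rule ln_add_one_self_le_self) simp
    finally have "real s * (ln (real (Suc s)) - ln (real s)) \<le> 1"
      using False by (simp add: field_simps)
    thus ?thesis using Suc.IH by (simp add: algebra_simps)
  qed simp
qed simp

lemma log_argument_gt_one:
  assumes "1 \<le> s" "s \<le> p"
  shows "1 < 2 * exp 1 * real p / real s"
proof -
  have e: "1 < 2 * exp (1 :: real)" using exp_ge_add_one_self[of "1::real"] by linarith
  have "1 * real s < 2 * exp 1 * real s" using e assms by (intro mult_strict_right_mono) auto
  also have "\<dots> \<le> 2 * exp 1 * real p" using assms by (intro mult_left_mono) auto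
  finally show ?thesis using assms by simp
qed

text \<open>
  The squared weights of the \<open>s\<close> largest entries are, on average, at most the level at which the
  tuning parameter is set; this is where the factor \<open>e\<close> in that level comes from.
\<close>

lemma sum_ln_div_le:
  fixes p :: real
  assumes "1 \<le> s" "0 < p"
  shows "(\<Sum>j=1..s. ln (2 * p / real j)) \<le> real s * ln (2 * exp 1 * p / real s)"
proof -
  have "(\<Sum>j=1..s. ln (2 * p / real j)) = (\<Sum>j=1..s. ln (2 * p) - ln (real j))"
    using assms by (intro sum.cong) (auto simp: ln_div)
  also have "\<dots> = real s * ln (2 * p) - (\<Sum>j=1..s. ln (real j))"
    by (simp add: sum_subtractf)
  also have "\<dots> \<le> real s * (ln (2 * p) + 1 - ln (real s))"
    using sum_ln_ge[of s] by (simp add: algebra_simps)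
  also have "ln (2 * p) + 1 - ln (real s) = ln (2 * exp 1 * p / real s)"
    using assms by (simp add: ln_div ln_mult)
  finally show ?thesis .
qed

text \<open>
  Listing the indices rather than the values by size keeps track of which entries are the largest
  ones, so that sums over ranks become sums over sets of coordinates.
\<close>

lemma decr_rearr_enumeration:
  fixes u :: "real ^ 'p"
  shows "\<exists>\<pi>. bij_betw \<pi> {1..CARD('p)} (UNIV :: 'p set) \<and>
     (\<forall>j\<in>{1..CARD('p)}. decr_rearr u j = \<bar>u $ \<pi> j\<bar>) \<and>
     (\<forall>i j. 1 \<le> i \<longrightarrow> i \<le> j \<longrightarrow> j \<le> CARD('p) \<longrightarrow> \<bar>u $ \<pi> j\<bar> \<le> \<bar>u $ \<pi> i\<bar>)"
proof -
  define f where "f = (\<lambda>i. \<bar>u $ i\<bar>)"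
  obtain zs :: "'p list" where zs: "set zs = UNIV" "distinct zs"
    using finite_distinct_list[OF finite[of UNIV]] by blast
  define xs where "xs = rev (sort_key f zs)"
  have xs: "set xs = UNIV" "distinct xs" using zs by (auto simp: xs_def)
  have len: "length xs = CARD('p)" using distinct_card[OF xs(2)] xs(1) by simp
  have sorted: "sorted (map f (rev xs))" by (simp add: xs_def)
  have "image_mset f (mset_set UNIV) = mset (map f (rev xs))"
    using mset_set_set[OF xs(2)] xs(1) by simp
  hence "sorted_list_of_multiset (image_mset f (mset_set UNIV)) = map f (rev xs)"
    by (simp only: sorted_list_of_multiset_mset sorted_sort_id[OF sorted])
  hence dr: "decr_rearr u j = map f xs ! (j - 1)" for j
    by (simp add: decr_rearr_def f_def rev_map)
  define \<pi> where "\<pi> j = xs ! (j - 1)" for j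
  have "bij_betw (\<lambda>j. j - 1) {1..CARD('p)} {..<CARD('p)}"
    by (rule bij_betw_byWitness[where f' = Suc]) auto
  moreover have "bij_betw ((!) xs) {..<CARD('p)} UNIV"
    using bij_betw_nth[OF xs(2), of "{..<CARD('p)}" UNIV] len xs(1) by simp
  ultimately have bij: "bij_betw \<pi> {1..CARD('p)} UNIV"
    unfolding \<pi>_def by (rule bij_betw_trans[unfolded comp_def])
  have "f (\<pi> j) \<le> f (\<pi> i)" if "1 \<le> i" "i \<le> j" "j \<le> CARD('p)" for i j
    using sorted_rev_nth_mono[of "map f xs" "i - 1" "j - 1"] sorted that len
    by (simp add: \<pi>_def rev_map)
  with bij dr len show ?thesis
    by (intro exI[of _ \<pi>]) (auto simp: f_def \<pi>_def)
qed

lemma sum_abs_le_sqrt_card_norm: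
  fixes u :: "real ^ 'p"
  shows "(\<Sum>j\<in>S. \<bar>u $ j\<bar>) \<le> sqrt (real (card S)) * norm u"
proof (rule power2_le_imp_le)
  have "(\<Sum>j\<in>S. 1 * \<bar>u $ j\<bar>)\<^sup>2 \<le> (\<Sum>j\<in>S. 1\<^sup>2) * (\<Sum>j\<in>S. \<bar>u $ j\<bar>\<^sup>2)"
    by (rule Cauchy_Schwarz_ineq_sum)
  also have "\<dots> \<le> real (card S) * (\<Sum>j\<in>UNIV. (u $ j)\<^sup>2)"
    by (auto intro!: mult_left_mono sum_mono2)
  also have "\<dots> = (sqrt (real (card S)) * norm u)\<^sup>2"
    by (simp add: power_mult_distrib norm_vec_def L2_set_def sum_nonneg)
  finally show "(\<Sum>j\<in>S. \<bar>u $ j\<bar>)\<^sup>2 \<le> (sqrt (real (card S)) * norm u)\<^sup>2" by simp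
qed simp

text \<open>
  Only the parts of \<open>T\<close> and \<open>S\<close> outside their intersection matter, and the smallest value of \<open>f\<close>
  on \<open>S - T\<close> separates them.
\<close>

lemma sum_le_sum_dominating:
  fixes f :: "'a \<Rightarrow> real"
  assumes "finite S" "finite T" "card T \<le> card S"
    and dom: "\<And>i j. i \<in> S \<Longrightarrow> j \<notin> S \<Longrightarrow> f j \<le> f i" and nonneg: "\<And>i. 0 \<le> f i"
  shows "sum f T \<le> sum f S"
proof (cases "S \<subseteq> T")
  case True
  hence "S = T" using assms by (intro card_seteq) auto
  thus ?thesis by simp
next
  case False
  define m where "m = Min (f ` (S - T))"
  have fin: "finite (f ` (S - T))" "f ` (S - T) \<noteq> {}" using False assms(1) by auto
  have m_le: "m \<le> f i" if "i \<in> S - T" for i using that fin by (simp add: m_def)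
  obtain i0 where i0: "i0 \<in> S - T" "m = f i0" using Min_in[OF fin] by (auto simp: m_def)
  have "card T = card (T \<inter> S) + card (T - S)" "card S = card (T \<inter> S) + card (S - T)"
    using assms card_Int_Diff[of T S] card_Int_Diff[of S T] by (auto simp: Int_commute)
  hence card: "card (T - S) \<le> card (S - T)" using assms by linarith
  have "sum f (T - S) \<le> real (card (T - S)) * m"
    using dom i0 by (intro sum_bounded_above) auto
  also have "\<dots> \<le> real (card (S - T)) * m"
    using card i0 nonneg by (intro mult_right_mono) auto
  also have "\<dots> \<le> sum f (S - T)"
    using m_le by (intro sum_bounded_below) auto
  finally have "sum f (T - S) \<le> sum f (S - T)" .
  moreover have "sum f T = sum f (T \<inter> S) + sum f (T - S)" "sum f S = sum f (T \<inter> S) + sum f (S - T)"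
    using sum.Int_Diff[of T f S] sum.Int_Diff[of S f T] assms by (auto simp: Int_commute)
  ultimately show ?thesis by linarith
qed

text \<open>
  The set \<open>S\<close> collects \<open>s\<close> largest entries of \<open>u\<close>. Their weights are handled jointly by
  Cauchy--Schwarz and \<open>sum_ln_div_le\<close>; every weight of a smaller entry is individually below the same
  level.
\<close>

lemma H_fun_le_largest_entries:
  fixes u :: "real ^ 'p"
  assumes s: "s \<in> {1..CARD('p)}" and \<sigma>: "0 \<le> \<sigma>"
  shows "\<exists>S :: 'p set. card S = s \<and> (\<forall>i\<in>S. \<forall>j\<in>-S. \<bar>u $ j\<bar> \<le> \<bar>u $ i\<bar>) \<and>
     H_fun TYPE('n::finite) \<sigma> u
       \<le> (4 + sqrt 2) * \<sigma> * sqrt (ln (2 * exp 1 * real CARD('p) / real s) / real CARD('n)) *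
          (sqrt (real s) * norm u + (\<Sum>j\<in>-S. \<bar>u $ j\<bar>))"
proof -
  define p where "p = CARD('p)"
  define N where "N = real CARD('n)"
  define l where "l = ln (2 * exp 1 * real p / real s)"
  define g where "g j = sqrt (ln (2 * real p / real j) / N)" for j
  have sp: "1 \<le> s" "s \<le> p" using s by (auto simp: p_def)
  have N: "N > 0" by (simp add: N_def)
  obtain \<pi> where bij: "bij_betw \<pi> {1..p} UNIV"
    and dr: "\<And>j. j \<in> {1..p} \<Longrightarrow> decr_rearr u j = \<bar>u $ \<pi> j\<bar>"
    and anti: "\<And>i j. 1 \<le> i \<Longrightarrow> i \<le> j \<Longrightarrow> j \<le> p \<Longrightarrow> \<bar>u $ \<pi> j\<bar> \<le> \<bar>u $ \<pi> i\<bar>"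
    using decr_rearr_enumeration[of u] unfolding p_def by blast
  define S where "S = \<pi> ` {1..s}"
  have inj: "inj_on \<pi> {1..p}" using bij by (rule bij_betw_imp_inj_on)
  have inj_s: "inj_on \<pi> {1..s}" using inj_on_subset[OF inj] sp by simp
  have inj_t: "inj_on \<pi> {s<..p}" using inj by (rule inj_on_subset) auto
  have card: "card S = s" using card_image[OF inj_s] by (simp add: S_def)
  have split: "{1..p} - {1..s} = {s<..p}" by auto
  have comp: "-S = \<pi> ` {s<..p}"
    using inj_on_image_set_diff[OF inj, of "{1..p}" "{1..s}"] bij_betw_imp_surj_on[OF bij] sp split
    by (auto simp: S_def)
  have dom: "\<forall>i\<in>S. \<forall>j\<in>-S. \<bar>u $ j\<bar> \<le> \<bar>u $ i\<bar>"
  proof (intro ballI)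
    fix i j assume "i \<in> S" "j \<in> -S"
    then obtain i' j' where "i' \<in> {1..s}" "i = \<pi> i'" "j' \<in> {s<..p}" "j = \<pi> j'"
      unfolding comp unfolding S_def by blast
    thus "\<bar>u $ j\<bar> \<le> \<bar>u $ i\<bar>" using anti[of i' j'] by simp
  qed
  have ln_nonneg: "0 \<le> ln (2 * real p / real j)" if "j \<in> {1..p}" for j
    using that by (intro ln_ge_zero) (auto simp: field_simps)
  have "(\<Sum>j\<in>{1..s}. \<bar>u $ \<pi> j\<bar> * g j) \<le> sqrt (real s) * norm u * sqrt (l / N)"
  proof (rule power2_le_imp_le)
    have "(\<Sum>j\<in>{1..s}. \<bar>u $ \<pi> j\<bar> * g j)\<^sup>2
        \<le> (\<Sum>j\<in>{1..s}. \<bar>u $ \<pi> j\<bar>\<^sup>2) * (\<Sum>j\<in>{1..s}. (g j)\<^sup>2)"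
      by (rule Cauchy_Schwarz_ineq_sum)
    also have "(\<Sum>j\<in>{1..s}. (g j)\<^sup>2) = (\<Sum>j=1..s. ln (2 * real p / real j)) / N"
      using sp N ln_nonneg by (auto simp: g_def sum_divide_distrib intro!: sum.cong)
    also have "\<dots> \<le> real s * l / N"
      using sum_ln_div_le[of s "real p"] sp N by (auto simp: l_def intro!: divide_right_mono)
    also have "(\<Sum>j\<in>{1..s}. \<bar>u $ \<pi> j\<bar>\<^sup>2) = (\<Sum>i\<in>S. (u $ i)\<^sup>2)"
      unfolding S_def by (subst sum.reindex[OF inj_s]) (simp add: comp_def)
    finally have *: "(\<Sum>j\<in>{1..s}. \<bar>u $ \<pi> j\<bar> * g j)\<^sup>2
        \<le> (\<Sum>i\<in>S. (u $ i)\<^sup>2) * (real s * l / N)"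
      by (simp add: mult_left_mono sum_nonneg)
    have l: "0 \<le> l" using log_argument_gt_one[OF sp] by (simp add: l_def)
    note *
    also have "(\<Sum>i\<in>S. (u $ i)\<^sup>2) * (real s * l / N) \<le> (\<Sum>i\<in>UNIV. (u $ i)\<^sup>2) * (real s * l / N)"
      using l N by (intro mult_right_mono sum_mono2) auto
    also have "\<dots> = (sqrt (real s) * norm u * sqrt (l / N))\<^sup>2"
      using l N by (simp add: power_mult_distrib norm_vec_def L2_set_def sum_nonneg)
    finally show "(\<Sum>j\<in>{1..s}. \<bar>u $ \<pi> j\<bar> * g j)\<^sup>2
        \<le> (sqrt (real s) * norm u * sqrt (l / N))\<^sup>2" .
    show "0 \<le> sqrt (real s) * norm u * sqrt (l / N)" using l N by simp
  qed
  moreover have "(\<Sum>j\<in>{s<..p}. \<bar>u $ \<pi> j\<bar> * g j) \<le> sqrt (l / N) * (\<Sum>j\<in>-S. \<bar>u $ j\<bar>)"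
  proof -
    have "g j \<le> sqrt (l / N)" if j: "j \<in> {s<..p}" for j
    proof -
      have "2 * real p / real j \<le> 2 * exp 1 * real p / real s"
        using j sp exp_ge_add_one_self[of "1::real"] by (intro frac_le mult_mono) auto
      hence "ln (2 * real p / real j) \<le> l"
        using j sp unfolding l_def by (subst ln_le_cancel_iff) auto
      thus ?thesis using N by (simp add: g_def divide_right_mono)
    qed
    hence "(\<Sum>j\<in>{s<..p}. \<bar>u $ \<pi> j\<bar> * g j) \<le> (\<Sum>j\<in>{s<..p}. \<bar>u $ \<pi> j\<bar> * sqrt (l / N))"
      by (intro sum_mono mult_left_mono) auto
    also have "\<dots> = sqrt (l / N) * (\<Sum>j\<in>-S. \<bar>u $ j\<bar>)"
      unfolding comp using inj_t
      by (subst sum.reindex) (auto simp: sum_distrib_left mult.commute)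
    finally show ?thesis .
  qed
  moreover have "(\<Sum>j\<in>{1..p}. \<bar>u $ \<pi> j\<bar> * g j)
      = (\<Sum>j\<in>{1..s}. \<bar>u $ \<pi> j\<bar> * g j) + (\<Sum>j\<in>{s<..p}. \<bar>u $ \<pi> j\<bar> * g j)"
    using sum.subset_diff[of "{1..s}" "{1..p}" "\<lambda>j. \<bar>u $ \<pi> j\<bar> * g j"] sp split by simp
  ultimately have "(\<Sum>j\<in>{1..p}. \<bar>u $ \<pi> j\<bar> * g j)
      \<le> sqrt (l / N) * (sqrt (real s) * norm u + (\<Sum>j\<in>-S. \<bar>u $ j\<bar>))"
    by (simp add: algebra_simps)
  hence "(4 + sqrt 2) * \<sigma> * (\<Sum>j\<in>{1..p}. \<bar>u $ \<pi> j\<bar> * g j)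
      \<le> (4 + sqrt 2) * \<sigma> * (sqrt (l / N) * (sqrt (real s) * norm u + (\<Sum>j\<in>-S. \<bar>u $ j\<bar>)))"
    using \<sigma> by (intro mult_left_mono) auto
  moreover have "H_fun TYPE('n) \<sigma> u = (4 + sqrt 2) * \<sigma> * (\<Sum>j\<in>{1..p}. \<bar>u $ \<pi> j\<bar> * g j)"
  proof -
    have "(\<Sum>j = 1..p. decr_rearr u j * \<sigma> * g j) = (\<Sum>j = 1..p. \<sigma> * (\<bar>u $ \<pi> j\<bar> * g j))"
      by (intro sum.cong) (auto simp: dr)
    thus ?thesis by (simp add: H_fun_def g_def p_def N_def sum_distrib_left mult.assoc)
  qed
  ultimately show ?thesis
    using card dom by (intro exI[of _ S]) (simp add: l_def N_def p_def mult.assoc)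
qed

text \<open>
  On the support \<open>T\<close> of \<open>\<beta>\<close> the penalty difference is at most the mass of \<open>b - \<beta>\<close>, and off \<open>T\<close> it
  equals minus that mass. The resulting bound, twice the mass on \<open>T\<close> minus the total mass, only grows
  when \<open>T\<close> is replaced by \<open>S\<close>.
\<close>

lemma l1_difference_le_largest_entries:
  fixes b \<beta> :: "real ^ 'p"
  assumes "l0_norm \<beta> \<le> card S"
    and dom: "\<And>i j. i \<in> S \<Longrightarrow> j \<notin> S \<Longrightarrow> \<bar>(b - \<beta>) $ j\<bar> \<le> \<bar>(b - \<beta>) $ i\<bar>"
  shows "lq_norm 1 \<beta> - lq_norm 1 b
    \<le> (\<Sum>j\<in>S. \<bar>(b - \<beta>) $ j\<bar>) - (\<Sum>j\<in>-S. \<bar>(b - \<beta>) $ j\<bar>)"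
proof -
  define a where "a j = \<bar>(b - \<beta>) $ j\<bar>" for j
  define T where "T = {j. \<beta> $ j \<noteq> 0}"
  have compl: "sum h UNIV = sum h A + sum h (-A)" for h :: "'p \<Rightarrow> real" and A
    using sum.Int_Diff[of UNIV h A] by (simp add: Compl_eq_Diff_UNIV)
  have "lq_norm 1 \<beta> - lq_norm 1 b = (\<Sum>j\<in>UNIV. \<bar>\<beta> $ j\<bar> - \<bar>b $ j\<bar>)"
    by (simp add: lq_norm_1 sum_subtractf)
  also have "\<dots> = (\<Sum>j\<in>T. \<bar>\<beta> $ j\<bar> - \<bar>b $ j\<bar>) + (\<Sum>j\<in>-T. \<bar>\<beta> $ j\<bar> - \<bar>b $ j\<bar>)" by (rule compl)
  also have "\<dots> \<le> sum a T + (\<Sum>j\<in>-T. - a j)"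
    by (intro add_mono sum_mono) (auto simp: a_def T_def)
  also have "\<dots> = 2 * sum a T - sum a UNIV" using compl[of a T] by (simp add: sum_negf)
  also have "sum a T \<le> sum a S"
    using assms unfolding a_def by (intro sum_le_sum_dominating) (auto simp: T_def l0_norm_def)
  finally show ?thesis using compl[of a S] by (simp add: a_def)
qed

section \<open>The restricted eigenvalue\<close>

lemma bdd_below_theta: "bdd_below ((\<lambda>\<delta>. emp_norm (X *v \<delta>) / norm \<delta>) ` A)"
  by (intro bdd_belowI2[of _ 0]) (simp add: emp_norm_nonneg)

lemma theta_norm_le:
  assumes "\<delta> \<in> SRE_cone s c"
  shows "theta X s c * norm \<delta> \<le> emp_norm (X *v \<delta>)"
proof (cases "\<delta> = 0")
  case False
  hence "theta X s c \<le> emp_norm (X *v \<delta>) / norm \<delta>"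
    unfolding theta_def using assms by (intro cINF_lower bdd_below_theta) auto
  thus ?thesis using False by (simp add: field_simps)
qed (simp add: emp_norm_nonneg)

lemma theta_antimono:
  assumes "1 \<le> s" "0 < c" "c \<le> c'"
  shows "theta X s c' \<le> theta X s c"
proof -
  have "SRE_cone s c \<subseteq> SRE_cone s c'"
    using assms unfolding SRE_cone_def
    by (auto intro!: mult_right_mono intro: order_trans)
  moreover have "SRE_cone s c - {0} \<noteq> {}" using theta_attained[OF assms(1,2)] by blast
  ultimately show ?thesis
    unfolding theta_def by (intro cINF_superset_mono bdd_below_theta) auto
qed

section \<open>Controlling the noise on the favourable event\<close>

text \<open>
  The quantity \<open>D\<close> is the excess that the square of \<open>emp_norm (X *v (b - \<beta>))\<close> has to absorb. The
  factor \<open>k\<close> is the square root of the maximum in the constant \<open>C_const\<close>, hence at least the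
  reciprocal \<open>1 / \<theta>\<close>, needed when \<open>b - \<beta>\<close> lies in the cone, and at least the factor needed when
  \<open>G_fun\<close> dominates. The alternative \<open>D < 0\<close> is strict because \<open>D \<ge> 0\<close> already puts \<open>b - \<beta>\<close> in the
  cone in the first of these cases; the estimation bound relies on this boundary case, where \<open>D\<close>
  may vanish.
\<close>

lemma noise_penalty_dichotomy:
  fixes X :: "real ^ 'p ^ 'n" and \<xi> :: "real ^ 'n"
  assumes \<sigma>: "\<sigma> > 0" and s: "s \<in> {1..CARD('p)}" and \<gamma>: "\<gamma> \<in> {0<..<1}"
    and \<tau>: "\<tau> \<in> {0..<1 - \<gamma>}" and \<theta>: "theta X s (c0_const \<gamma> \<tau>) > 0"
    and lam: "lam \<ge> (4 + sqrt 2) * \<sigma> / \<gamma> *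
           sqrt (ln (2 * exp 1 * real CARD('p) / real s) / real CARD('n))"
    and lam_pos: "lam > 0"
    and \<delta>0: "\<delta>0 \<in> {0<..<1}"
    and event: "(\<xi> \<bullet> (X *v (b - \<beta>))) / real CARD('n)
      \<le> max (H_fun TYPE('n) \<sigma> (b - \<beta>)) (G_fun X \<sigma> \<delta>0 (b - \<beta>))"
    and sparse: "l0_norm \<beta> \<le> s"
  defines "D \<equiv> \<tau> * lam * lq_norm 1 (b - \<beta>) + (\<xi> \<bullet> (X *v (b - \<beta>))) / real CARD('n)
      + lam * (lq_norm 1 \<beta> - lq_norm 1 b)"
    and "k \<equiv> sqrt (C_const X \<sigma> \<gamma> \<tau> s lam \<delta>0) / (1 + \<gamma> + \<tau>)"
  shows "D < 0 \<or> norm (b - \<beta>) \<le> k * emp_norm (X *v (b - \<beta>)) \<and>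
    D \<le> lam * sqrt (real s) * (1 + \<gamma> + \<tau>) * k * emp_norm (X *v (b - \<beta>))"
proof (cases "D < 0")
  case False
  hence D: "D \<ge> 0" by simp
  define u where "u = b - \<beta>"
  define R where "R = emp_norm (X *v u)"
  define N where "N = real CARD('n)"
  define W where "W = (\<xi> \<bullet> (X *v u)) / N"
  define th where "th = theta X s (c0_const \<gamma> \<tau>)"
  define x where "x = \<gamma> * lam * sqrt N / ((4 + sqrt 2) * \<sigma>)"
  define L where "L = ln (1 / \<delta>0) / (real s * x\<^sup>2)"
  have N: "N > 0" by (simp add: N_def)
  have K: "(4 + sqrt 2) * \<sigma> > 0" using \<sigma> by (intro mult_pos_pos add_pos_nonneg) auto
  have x: "x > 0" using \<gamma> lam_pos N K by (auto simp: x_def intro!: divide_pos_pos)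
  have s0: "real s > 0" using s by simp
  have th: "th > 0" using \<theta> by (simp add: th_def)
  have g: "0 < 1 + \<gamma> + \<tau>" "0 \<le> \<tau>" "0 < \<gamma>" "0 < 1 - \<gamma> - \<tau>" using \<gamma> \<tau> by auto
  have R: "R \<ge> 0" by (simp add: R_def emp_norm_nonneg)
  have ln\<delta>: "ln (1 / \<delta>0) > 0" using \<delta>0 by (simp add: ln_div)
  have "ln (1 / delta_lam TYPE('n) \<sigma> \<gamma> lam) = x\<^sup>2"
    by (simp add: delta_lam_def ln_div x_def N_def)
  hence C: "C_const X \<sigma> \<gamma> \<tau> s lam \<delta>0 = (1 + \<gamma> + \<tau>)\<^sup>2 * max L (1 / th\<^sup>2)"
    by (simp add: C_const_def L_def th_def)
  hence k: "k = sqrt (max L (1 / th\<^sup>2))" using g by (simp add: k_def real_sqrt_mult)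
  have kth: "1 / th \<le> k"
  proof -
    have "sqrt (1 / th\<^sup>2) \<le> k" unfolding k by (intro real_sqrt_le_mono) simp
    thus ?thesis using th by (simp add: real_sqrt_divide)
  qed
  have kL: "sqrt L \<le> k" unfolding k by (intro real_sqrt_le_mono) simp
  obtain S :: "'p set" where S: "card S = s" "\<forall>i\<in>S. \<forall>j\<in>-S. \<bar>u $ j\<bar> \<le> \<bar>u $ i\<bar>"
    and H: "H_fun TYPE('n) \<sigma> u \<le> (4 + sqrt 2) * \<sigma> *
       sqrt (ln (2 * exp 1 * real CARD('p) / real s) / real CARD('n)) *
          (sqrt (real s) * norm u + (\<Sum>j\<in>-S. \<bar>u $ j\<bar>))"
    using H_fun_le_largest_entries[OF s, of \<sigma> u, where 'n='n] \<sigma> by auto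
  define A where "A = (\<Sum>j\<in>S. \<bar>u $ j\<bar>)"
  define B where "B = (\<Sum>j\<in>-S. \<bar>u $ j\<bar>)"
  define P where "P = sqrt (real s) * norm u"
  have B: "B \<ge> 0" and P: "P \<ge> 0" by (auto simp: B_def P_def sum_nonneg)
  have AP: "A \<le> P" using sum_abs_le_sqrt_card_norm[of u S] S by (simp add: A_def P_def)
  have l1: "lq_norm 1 u = A + B"
    using sum.Int_Diff[of UNIV "\<lambda>j. \<bar>u $ j\<bar>" S] by (simp add: lq_norm_1 A_def B_def Compl_eq_Diff_UNIV)
  have "(4 + sqrt 2) * \<sigma> * sqrt (ln (2 * exp 1 * real CARD('p) / real s) / real CARD('n)) \<le> \<gamma> * lam"
    using lam g by (simp add: field_simps)
  hence "H_fun TYPE('n) \<sigma> u \<le> \<gamma> * lam * (P + B)"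
    using H B P unfolding P_def[symmetric] B_def[symmetric]
    by (meson mult_right_mono add_nonneg_nonneg order_trans)
  hence HB: "H_fun TYPE('n) \<sigma> u \<le> lam * (\<gamma> * (P + B))" by (simp add: mult_ac)
  have G: "G_fun X \<sigma> \<delta>0 u = lam * (\<gamma> * (sqrt (real s) * sqrt L * R))"
  proof -
    have "sqrt (real s) * sqrt L = sqrt (ln (1 / \<delta>0)) / x"
      using s0 x by (simp add: L_def real_sqrt_divide real_sqrt_mult)
    moreover have "\<gamma> * lam / x = (4 + sqrt 2) * \<sigma> / sqrt N"
      using g lam_pos K N x by (simp add: x_def field_simps)
    moreover have "lam * (\<gamma> * (sqrt (ln (1 / \<delta>0)) / x * R)) = \<gamma> * lam / x * (sqrt (ln (1 / \<delta>0)) * R)"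
      by simp
    ultimately have "lam * (\<gamma> * (sqrt (real s) * sqrt L * R))
        = (4 + sqrt 2) * \<sigma> / sqrt N * (sqrt (ln (1 / \<delta>0)) * R)"
      by (simp only:)
    thus ?thesis by (simp add: G_fun_def R_def N_def real_sqrt_divide)
  qed
  have "D = \<tau> * lam * (A + B) + W + lam * (lq_norm 1 \<beta> - lq_norm 1 b)"
    by (simp add: D_def W_def l1[symmetric] u_def N_def)
  also have "\<dots> \<le> \<tau> * lam * (A + B) + W + lam * (A - B)"
    using l1_difference_le_largest_entries[of \<beta> S b] S sparse lam_pos
    by (simp add: A_def B_def u_def)
  finally have DW: "D \<le> lam * (\<tau> * (A + B) + A - B) + W" by (simp add: algebra_simps)
  have W: "W \<le> max (H_fun TYPE('n) \<sigma> u) (G_fun X \<sigma> \<delta>0 u)" using event by (simp add: W_def u_def N_def)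
  have "(1 + \<tau>) * A \<le> (1 + \<tau>) * P" using AP g by (intro mult_left_mono) auto
  hence mid: "\<tau> * (A + B) + A - B \<le> (1 + \<tau>) * P - (1 - \<tau>) * B" by (simp add: algebra_simps)
  \<comment> \<open>By \<open>HB\<close> and \<open>G\<close>, the case distinction compares the bound for \<open>H_fun\<close> with \<open>G_fun\<close>, both
    divided by \<open>\<gamma> lam\<close>.\<close>
  have main: "norm u \<le> k * R \<and> D \<le> lam * ((1 + \<gamma> + \<tau>) * (sqrt (real s) * (k * R)))"
  proof (cases "sqrt (real s) * sqrt L * R \<le> P + B")
    case True
    hence "\<gamma> * (sqrt (real s) * sqrt L * R) \<le> \<gamma> * (P + B)" using g by (intro mult_left_mono) auto
    hence "G_fun X \<sigma> \<delta>0 u \<le> lam * (\<gamma> * (P + B))"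
      unfolding G using lam_pos by (simp only: mult_le_cancel_left_pos)
    hence "W \<le> lam * (\<gamma> * (P + B))" using W HB by linarith
    hence "D \<le> lam * (\<tau> * (A + B) + A - B + \<gamma> * (P + B))"
      using DW by (simp add: algebra_simps)
    also have "\<dots> \<le> lam * ((1 + \<gamma> + \<tau>) * P - (1 - \<gamma> - \<tau>) * B)"
      using mid lam_pos by (intro mult_left_mono) (auto simp: algebra_simps)
    finally have D2: "D \<le> lam * ((1 + \<gamma> + \<tau>) * P - (1 - \<gamma> - \<tau>) * B)" .
    hence "0 \<le> lam * ((1 + \<gamma> + \<tau>) * P - (1 - \<gamma> - \<tau>) * B)" using D by simp
    \<comment> \<open>The ratio of the two coefficients is \<^term>\<open>c0_const \<gamma> \<tau>\<close>.\<close>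
    hence "(1 - \<gamma> - \<tau>) * B \<le> (1 + \<gamma> + \<tau>) * P" using lam_pos by (simp add: zero_le_mult_iff)
    hence "B \<le> c0_const \<gamma> \<tau> * P" using g by (simp add: c0_const_def field_simps)
    hence "u \<in> SRE_cone s (c0_const \<gamma> \<tau>)"
      using AP by (simp add: SRE_cone_def l1 P_def algebra_simps)
    hence "th * norm u \<le> R" unfolding th_def R_def by (rule theta_norm_le)
    hence "norm u \<le> 1 / th * R" using th by (simp add: field_simps)
    also have "\<dots> \<le> k * R" using kth R by (rule mult_right_mono)
    finally have u: "norm u \<le> k * R" .
    have "(1 + \<gamma> + \<tau>) * P - (1 - \<gamma> - \<tau>) * B \<le> (1 + \<gamma> + \<tau>) * P" using g B by simp
    also have "\<dots> \<le> (1 + \<gamma> + \<tau>) * (sqrt (real s) * (k * R))"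
      unfolding P_def using g u by (intro mult_left_mono) auto
    finally show ?thesis using D2 u lam_pos by (meson mult_left_mono order_trans less_imp_le)
  next
    case False
    define Z where "Z = sqrt (real s) * sqrt L * R"
    have PZ: "P + B < Z" using False by (simp add: Z_def)
    have "\<gamma> * (P + B) \<le> \<gamma> * Z" using g PZ by (intro mult_left_mono) auto
    hence "lam * (\<gamma> * (P + B)) \<le> lam * (\<gamma> * Z)" using lam_pos by (simp only: mult_le_cancel_left_pos)
    hence "W \<le> lam * (\<gamma> * Z)" using W HB by (simp add: G Z_def)
    hence "D \<le> lam * (\<tau> * (A + B) + A - B + \<gamma> * Z)"
      using DW by (simp add: algebra_simps)
    also have "\<dots> \<le> lam * ((1 + \<gamma> + \<tau>) * Z)"
    proof (intro mult_left_mono)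
      have "(1 + \<tau>) * P \<le> (1 + \<tau>) * Z" using PZ B g by (intro mult_left_mono) auto
      moreover have "(1 - \<tau>) * B \<ge> 0" using g B by simp
      ultimately have "\<tau> * (A + B) + A - B \<le> (1 + \<tau>) * Z" using mid by linarith
      thus "\<tau> * (A + B) + A - B + \<gamma> * Z \<le> (1 + \<gamma> + \<tau>) * Z" by (simp add: algebra_simps)
    qed (use lam_pos in simp)
    also have "\<dots> \<le> lam * ((1 + \<gamma> + \<tau>) * (sqrt (real s) * (k * R)))"
      unfolding Z_def mult.assoc using kL R g lam_pos
      by (intro mult_left_mono mult_right_mono) auto
    finally have D2: "D \<le> lam * ((1 + \<gamma> + \<tau>) * (sqrt (real s) * (k * R)))" .
    have "sqrt (real s) * norm u \<le> sqrt (real s) * (sqrt L * R)"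
      using PZ B by (simp add: P_def Z_def)
    hence "norm u \<le> sqrt L * R" using s0 by simp
    also have "\<dots> \<le> k * R" using kL R by (rule mult_right_mono)
    finally show ?thesis using D2 by simp
  qed
  thus ?thesis by (simp add: u_def R_def mult_ac)
qed simp

section \<open>Interpolation between the norms\<close>

text \<open>
  Hoelder's inequality for \<open>|x|^q = |x|^(2 - q) (x\<^sup>2)^(q - 1)\<close>, obtained by normalising \<open>|x|\<close>
  and \<open>x\<^sup>2\<close> to have sum \<open>1\<close> and applying the weighted arithmetic--geometric mean inequality entrywise.
\<close>

lemma lq_norm_interpolation:
  fixes v :: "real ^ 'p"
  assumes q: "q \<in> {1..2}"
  shows "lq_norm q v \<le> lq_norm 1 v powr (2 / q - 1) * norm v powr (2 - 2 / q)"
proof (cases "v = 0")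
  case False
  define a where "a = lq_norm 1 v"
  define c where "c = (norm v)\<^sup>2"
  have c: "c > 0" using False by (simp add: c_def)
  have cs: "c = (\<Sum>j\<in>UNIV. \<bar>v $ j\<bar>\<^sup>2)"
    by (simp add: c_def norm_vec_def L2_set_def sum_nonneg)
  obtain i where "v $ i \<noteq> 0" using False by (auto simp: vec_eq_iff)
  hence a: "a > 0" unfolding a_def lq_norm_1 by (intro sum_pos2[of _ i]) auto
  have point: "\<bar>v $ j\<bar> powr q
      \<le> a powr (2 - q) * c powr (q - 1) * ((2 - q) * (\<bar>v $ j\<bar> / a) + (q - 1) * (\<bar>v $ j\<bar>\<^sup>2 / c))" for j
  proof (cases "v $ j = 0")
    case False
    define y where "y = \<bar>v $ j\<bar>"
    have y: "y > 0" using False by (simp add: y_def)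
    have "(y / a) powr (2 - q) * (y\<^sup>2 / c) powr (q - 1) \<le> (2 - q) * (y / a) + (q - 1) * (y\<^sup>2 / c)"
      using q a c y by (intro Youngs_inequality_0) auto
    moreover have "(y / a) powr (2 - q) * (y\<^sup>2 / c) powr (q - 1)
        = y powr q / (a powr (2 - q) * c powr (q - 1))"
    proof -
      have "(y\<^sup>2) powr (q - 1) = y powr (2 * (q - 1))"
        using y by (simp add: powr_powr powr_numeral[symmetric] del: powr_numeral)
      hence "y powr (2 - q) * (y\<^sup>2) powr (q - 1) = y powr q"
        by (simp add: flip: powr_add)
      thus ?thesis using y a c by (simp add: powr_divide)
    qed
    moreover have "0 < a powr (2 - q) * c powr (q - 1)" using a c by simp
    ultimately have "y powr q \<le> ((2 - q) * (y / a) + (q - 1) * (y\<^sup>2 / c)) * (a powr (2 - q) * c powr (q - 1))"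
      by (simp only: pos_divide_le_eq)
    thus ?thesis unfolding y_def by (simp only: mult_ac)
  qed (use q in auto)
  have "(\<Sum>j\<in>UNIV. \<bar>v $ j\<bar> powr q) \<le> a powr (2 - q) * c powr (q - 1) *
      (\<Sum>j\<in>UNIV. (2 - q) * (\<bar>v $ j\<bar> / a) + (q - 1) * (\<bar>v $ j\<bar>\<^sup>2 / c))"
    unfolding sum_distrib_left by (intro sum_mono point)
  also have "(\<Sum>j\<in>UNIV. (2 - q) * (\<bar>v $ j\<bar> / a) + (q - 1) * (\<bar>v $ j\<bar>\<^sup>2 / c))
      = (2 - q) * (a / a) + (q - 1) * (c / c)"
    unfolding sum.distrib sum_distrib_left[symmetric] sum_divide_distrib[symmetric] cs[symmetric]
    by (simp add: a_def lq_norm_1)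
  also have "\<dots> = 1" using a c by simp
  finally have sum: "(\<Sum>j\<in>UNIV. \<bar>v $ j\<bar> powr q) \<le> a powr (2 - q) * c powr (q - 1)" by simp
  have "c = norm v powr 2" using False by (simp add: c_def)
  hence "lq_norm q v \<le> (a powr (2 - q) * (norm v powr 2) powr (q - 1)) powr (1 / q)"
    unfolding lq_norm_def using q sum by (intro powr_mono2) (auto intro: sum_nonneg)
  also have "\<dots> = a powr ((2 - q) / q) * norm v powr (2 * (q - 1) / q)"
    by (simp add: powr_mult powr_powr del: powr_numeral)
  also have "(2 - q) / q = 2 / q - 1" using q by (simp add: field_simps)
  also have "2 * (q - 1) / q = 2 - 2 / q" using q by (simp add: field_simps)
  finally show ?thesis by (simp add: a_def)
qed (simp add: lq_norm_def)

section \<open>The prediction bound and the estimation bounds\<close>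

theorem theorem4p2:
  fixes X :: "real ^ 'p ^ 'n"
    and M :: "'w measure"
    and \<xi> :: "'w \<Rightarrow> real ^ 'n"
    and s :: nat
    and \<sigma> \<gamma> \<tau> lam \<delta>0 :: real
  assumes "\<sigma> > 0"
    and "prob_space M"
    and "isotropic_gaussian M \<sigma> \<xi>"
    and "s \<in> {1..CARD('p)}"
    and "\<gamma> \<in> {0<..<1}"
    and "\<tau> \<in> {0..<1 - \<gamma>}"
    and "SRE X s (c0_const \<gamma> \<tau>)"
    and "lam \<ge> (4 + sqrt 2) * \<sigma> / \<gamma> *
           sqrt (ln (2 * exp 1 * real CARD('p) / real s) / real CARD('n))"
    and "\<delta>0 \<in> {0<..<1}"
  shows "\<forall>\<omega> \<in> Omega_event M \<xi> X \<sigma> \<delta>0.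
     (\<forall>f \<beta>hat \<beta>. is_lasso X lam (f + \<xi> \<omega>) \<beta>hat \<longrightarrow> l0_norm \<beta> \<le> s \<longrightarrow>
        2 * \<tau> * lam * lq_norm 1 (\<beta>hat - \<beta>) + (emp_norm (X *v \<beta>hat - f))\<^sup>2
          \<le> (emp_norm (X *v \<beta> - f))\<^sup>2 + C_const X \<sigma> \<gamma> \<tau> s lam \<delta>0 * lam\<^sup>2 * real s) \<and>
     (\<forall>f \<beta>hat \<beta>star. is_lasso X lam (f + \<xi> \<omega>) \<beta>hat \<longrightarrow>
        f = X *v \<beta>star \<longrightarrow> l0_norm \<beta>star \<le> s \<longrightarrow>
        (\<forall>q \<in> {1..2}.
           ereal (lq_norm q (\<beta>hat - \<beta>star))
             \<le> tau_factor (C_const X \<sigma> \<gamma> \<tau> s lam \<delta>0) \<tau> q *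
               ereal ((C_const X \<sigma> \<gamma> 0 s lam \<delta>0 / (1 + \<gamma>)) powr (2 - 2 / q) *
                      lam * real s powr (1 / q))))"
proof -
  have s: "1 \<le> s" "s \<le> CARD('p)" using assms(4) by auto
  have g: "0 < \<gamma>" "0 \<le> \<tau>" "0 < 1 - \<gamma> - \<tau>" using assms(5,6) by auto
  have th: "theta X s (c0_const \<gamma> \<tau>) > 0" using assms(7) by (simp add: SRE_def)
  \<comment> \<open>The constant for \<open>\<tau> = 0\<close> refers to a smaller cone, hence to a larger restricted eigenvalue.\<close>
  have th0: "theta X s (c0_const \<gamma> 0) > 0"
  proof -
    have "0 < c0_const \<gamma> 0" "c0_const \<gamma> 0 \<le> c0_const \<gamma> \<tau>"
      using g by (auto simp: c0_const_def intro!: frac_le)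
    from theta_antimono[OF s(1) this, of X] th show ?thesis by simp
  qed
  have lam: "lam > 0"
  proof -
    have "1 < 2 * exp 1 * real CARD('p) / real s"
      by (rule log_argument_gt_one[OF s])
    hence "0 < (4 + sqrt 2) * \<sigma> / \<gamma> *
           sqrt (ln (2 * exp 1 * real CARD('p) / real s) / real CARD('n))"
      using assms(1) g by (intro mult_pos_pos divide_pos_pos add_pos_nonneg) auto
    thus ?thesis using assms(8) by linarith
  qed
  have Cpos: "C_const X \<sigma> \<gamma> t s lam \<delta>0 > 0"
    if "theta X s (c0_const \<gamma> t) > 0" "t \<ge> 0" for t
    using that g unfolding C_const_def by (intro mult_pos_pos) (auto simp: less_max_iff_disj)
  define C where "C = C_const X \<sigma> \<gamma> \<tau> s lam \<delta>0"
  define C0 where "C0 = C_const X \<sigma> \<gamma> 0 s lam \<delta>0"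
  have C: "C > 0" "C0 > 0" using Cpos[OF th] Cpos[OF th0] g by (auto simp: C_def C0_def)
  note dichotomy = noise_penalty_dichotomy[where X = X, OF assms(1,4,5) _ _ assms(8) lam assms(9)]
  have prediction: "2 * \<tau> * lam * lq_norm 1 (b - \<beta>) + (emp_norm (X *v b - f))\<^sup>2
          \<le> (emp_norm (X *v \<beta> - f))\<^sup>2 + C * lam\<^sup>2 * real s"
    if \<omega>: "\<omega> \<in> Omega_event M \<xi> X \<sigma> \<delta>0" and lasso: "is_lasso X lam (f + \<xi> \<omega>) b"
      and sparse: "l0_norm \<beta> \<le> s" for \<omega> f b \<beta>
  proof -
    define R where "R = emp_norm (X *v (b - \<beta>))"
    define D where "D = \<tau> * lam * lq_norm 1 (b - \<beta>)
      + (\<xi> \<omega> \<bullet> (X *v (b - \<beta>))) / real CARD('n) + lam * (lq_norm 1 \<beta> - lq_norm 1 b)"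
    have basic: "2 * \<tau> * lam * lq_norm 1 (b - \<beta>) + (emp_norm (X *v b - f))\<^sup>2 + R\<^sup>2
        \<le> (emp_norm (X *v \<beta> - f))\<^sup>2 + 2 * D"
      using lasso_optimality[OF lasso, of \<beta>] lam by (simp add: R_def D_def algebra_simps)
    have "2 * D \<le> R\<^sup>2 + C * lam\<^sup>2 * real s"
    proof -
      have "D < 0 \<or> D \<le> lam * sqrt (real s) * sqrt C * R"
        using dichotomy[OF assms(6) th _ sparse, of "\<xi> \<omega>" b] \<omega> g
        by (auto simp: Omega_event_def C_def D_def R_def)
      moreover have "2 * (lam * sqrt (real s) * sqrt C * R) \<le> R\<^sup>2 + C * lam\<^sup>2 * real s"
      proof -
        \<comment> \<open>completing the square, so that the term \<^term>\<open>R\<^sup>2\<close> of the optimality inequality absorbs \<^term>\<open>R\<close>\<close>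
        have "0 \<le> (lam * sqrt (real s) * sqrt C - R)\<^sup>2" by simp
        thus ?thesis using C by (simp add: power2_diff power_mult_distrib algebra_simps)
      qed
      moreover have "0 \<le> R\<^sup>2 + C * lam\<^sup>2 * real s" using C by simp
      ultimately show ?thesis by linarith
    qed
    with basic show ?thesis by linarith
  qed
  have l2: "norm (b - \<beta>) \<le> C0 / (1 + \<gamma>) * (lam * sqrt (real s))"
    if \<omega>: "\<omega> \<in> Omega_event M \<xi> X \<sigma> \<delta>0" and lasso: "is_lasso X lam (X *v \<beta> + \<xi> \<omega>) b"
      and sparse: "l0_norm \<beta> \<le> s" for \<omega> b \<beta>
  proof -
    define R where "R = emp_norm (X *v (b - \<beta>))"
    define k where "k = sqrt C0 / (1 + \<gamma>)"
    define D where "D = (\<xi> \<omega> \<bullet> (X *v (b - \<beta>))) / real CARD('n) + lam * (lq_norm 1 \<beta> - lq_norm 1 b)"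
    have R: "R \<ge> 0" by (simp add: R_def emp_norm_nonneg)
    have k: "k \<ge> 0" using C g by (simp add: k_def)
    have "emp_norm (X *v \<beta> - X *v \<beta>) = 0" by (simp add: emp_norm_def)
    hence RD: "R\<^sup>2 \<le> D"
      using lasso_optimality[OF lasso, of \<beta>] lam
      by (simp add: R_def D_def matrix_vector_mult_diff_distrib)
    \<comment> \<open>Without approximation error \<^term>\<open>D\<close> dominates a square, which leaves only the second alternative.\<close>
    hence "\<not> D < 0" using zero_le_power2[of R] by linarith
    moreover have "(0::real) \<in> {0..<1 - \<gamma>}" using g by auto
    ultimately have *: "norm (b - \<beta>) \<le> k * R" "D \<le> lam * sqrt (real s) * (1 + \<gamma>) * k * R"
      using dichotomy[OF _ th0 _ sparse, of "\<xi> \<omega>" b] \<omega>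
      by (auto simp: Omega_event_def C0_def D_def R_def k_def)
    have "R \<le> lam * sqrt (real s) * (1 + \<gamma>) * k"
    proof (cases "R = 0")
      case False
      have "R * R \<le> (lam * sqrt (real s) * (1 + \<gamma>) * k) * R"
        using RD *(2) by (simp add: power2_eq_square)
      thus ?thesis using False R by simp
    qed (use lam k g in auto)
    hence "k * R \<le> k * (lam * sqrt (real s) * (1 + \<gamma>) * k)" using k by (rule mult_left_mono)
    also have "\<dots> = (k * k * (1 + \<gamma>)) * (lam * sqrt (real s))" by simp
    also have "k * k * (1 + \<gamma>) = C0 / (1 + \<gamma>)" using C g by (simp add: k_def)
    finally show ?thesis using *(1) by linarith
  qed
  have lq: "ereal (lq_norm q (b - \<beta>)) \<le> tau_factor C \<tau> q *
       ereal ((C0 / (1 + \<gamma>)) powr (2 - 2 / q) * lam * real s powr (1 / q))"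
    if \<omega>: "\<omega> \<in> Omega_event M \<xi> X \<sigma> \<delta>0" and lasso: "is_lasso X lam (X *v \<beta> + \<xi> \<omega>) b"
      and sparse: "l0_norm \<beta> \<le> s" and q: "q \<in> {1..2}" for \<omega> b \<beta> q
  proof -
    define Y where "Y = (C0 / (1 + \<gamma>)) powr (2 - 2 / q) * lam * real s powr (1 / q)"
    have Y: "Y > 0" using C g lam s by (simp add: Y_def)
    have q': "2 / q - 1 \<ge> 0" "2 - 2 / q \<ge> 0" using q by (auto simp: field_simps)
    consider "\<tau> = 0" "q < 2" | "\<tau> = 0" "q = 2" | "\<tau> > 0" using g q by fastforce
    then show ?thesis
    proof cases
      case 1
      thus ?thesis using Y by (simp add: tau_factor_def Y_def[symmetric])
    next
      case 2
      thus ?thesis using l2[OF \<omega> lasso sparse] C g s lam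
        by (simp add: tau_factor_def lq_norm_2 powr_half_sqrt mult.assoc)
    next
      case 3
      have "(emp_norm (X *v \<beta> - X *v \<beta>))\<^sup>2 = 0" by (simp add: emp_norm_def)
      hence "2 * \<tau> * lam * lq_norm 1 (b - \<beta>) \<le> C * lam\<^sup>2 * real s"
        using prediction[OF \<omega> lasso sparse] zero_le_power2[of "emp_norm (X *v b - X *v \<beta>)"]
        by linarith
      hence l1: "lq_norm 1 (b - \<beta>) \<le> C / (2 * \<tau>) * (lam * real s)"
        using 3 lam by (simp add: field_simps power2_eq_square)
      have "lq_norm q (b - \<beta>)
          \<le> lq_norm 1 (b - \<beta>) powr (2 / q - 1) * norm (b - \<beta>) powr (2 - 2 / q)"
        by (rule lq_norm_interpolation[OF q])
      also have "\<dots> \<le> (C / (2 * \<tau>) * (lam * real s)) powr (2 / q - 1)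
          * (C0 / (1 + \<gamma>) * (lam * sqrt (real s))) powr (2 - 2 / q)"
        using l1 l2[OF \<omega> lasso sparse] q'
        by (intro mult_mono powr_mono2) (auto simp: lq_norm_1 sum_nonneg)
      also have "\<dots> = (C / (2 * \<tau>)) powr (2 / q - 1) * (C0 / (1 + \<gamma>)) powr (2 - 2 / q) *
          ((lam * real s) powr (2 / q - 1) * (lam * sqrt (real s)) powr (2 - 2 / q))"
        using C 3 lam g s by (subst (1 2) powr_mult) auto
      also have "(lam * real s) powr (2 / q - 1) * (lam * sqrt (real s)) powr (2 - 2 / q)
          = (lam powr (2 / q - 1) * lam powr (2 - 2 / q)) *
            (real s powr (2 / q - 1) * real s powr (1 / 2 * (2 - 2 / q)))"
        using lam s by (simp add: powr_mult powr_powr flip: powr_half_sqrt)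
      also have "lam powr (2 / q - 1) * lam powr (2 - 2 / q) = lam"
        using lam by (simp flip: powr_add)
      also have "real s powr (2 / q - 1) * real s powr (1 / 2 * (2 - 2 / q)) = real s powr (1 / q)"
        unfolding powr_add[symmetric] by (simp add: field_simps)
      finally show ?thesis using 3 by (simp add: tau_factor_def mult.assoc)
    qed
  qed
  show ?thesis
    using prediction lq unfolding C_def C0_def by blast
qed

end
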